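(* Let $A=\{a_1,a_2\}$, where $a_1\neq a_2$ are positive integers. Then for each polynomial $f\in\mathbb{Z}[x]$ with positive leading coefficient, the Diophantine equation $P_A(x)=f(y)$ has infinitely many solutions $(x,y)$ in positive integers.
   Context: For a set $A$ of positive integers and a non-negative integer $n$, $P_A(n)$ denotes the number of partitions of $n$ into parts from $A$, i.e. the number of representations $n=\lambda_1+\dots+\lambda_k$ with all $\lambda_i\in A$ (repetitions of parts allowed), where representations differing only in the order of the terms are counted as one; $P_A(0)=1$. Equivalently, $\prod_{a\in A}\frac{1}{1-x^a}=\sum_{n=0}^\infty P_A(n)x^n$. *)

theory Defs
  imports "HOL-Library.Multiset" "HOL-Computational_Algebra.Polynomial"
begin

text \<open>A partition of \<open>n\<close> into parts from \<open>A\<close> is a finite multiset of elements of \<open>A\<close>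
  with sum \<open>n\<close>; the empty multiset is the unique partition of \<open>0\<close>. The definition is
  meant for \<open>0 \<notin> A\<close>: then the set below is finite, otherwise it may be infinite and
  \<^const>\<open>card\<close> would return \<open>0\<close>.\<close>

definition partition_count :: "nat set \<Rightarrow> nat \<Rightarrow> nat" where
  "partition_count A n = card {M :: nat multiset. set_mset M \<subseteq> A \<and> sum_mset M = n}"

end

theory Submission
  imports Defs
begin

text \<open>If \<open>a1 < a2\<close> have greatest common divisor \<open>g\<close>, \<open>a1 = b * g\<close> and \<open>a2 = c * g\<close>, then \<open>c\<close>
  copies of \<open>a1\<close> can be traded for \<open>b\<close> copies of \<open>a2\<close>, and \<open>x = a1 + m * lcm a1 a2\<close> has exactly
  the \<open>m + 1\<close> partitions with \<open>1 + c * t\<close> parts \<open>a1\<close> and \<open>b * (m - t)\<close> parts \<open>a2\<close>, \<open>0 \<le> t \<le> m\<close>.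
  Hence \<open>P\<^sub>A\<close> takes every positive value at a positive argument, in particular every value
  \<open>f(y)\<close> with \<open>y\<close> large.\<close>

lemma eventually_poly_pos:
  fixes p :: "int poly"
  assumes "lead_coeff p > 0"
  shows "\<exists>N. \<forall>y\<ge>N. poly p y > 0"
  using assms
proof (induction p)
  case 0
  then show ?case by simp
next
  case (pCons a q)
  show ?case
  proof (cases "q = 0")
    case True
    with pCons.prems show ?thesis by simp
  next
    case False
    then obtain N where N: "\<And>y. y \<ge> N \<Longrightarrow> poly q y > 0"
      using pCons by auto
    \<comment> \<open>Over the integers \<open>poly q y > 0\<close> means
      \<open>poly q y \<ge> 1\<close>, so the term \<open>y * poly q y\<close> is at least
      \<open>y\<close> and outweighs \<open>a\<close>.\<close>
    have "poly (pCons a q) y > 0" if y: "y \<ge> max N (\<bar>a\<bar> + 1)" for y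
    proof -
      have "y * 1 \<le> y * poly q y"
        using N[of y] y by (intro mult_left_mono) auto
      with y show ?thesis by auto
    qed
    then show ?thesis by blast
  qed
qed

lemma mset_two_elements:
  assumes "set_mset M \<subseteq> {a, b}" "a \<noteq> b"
  shows "M = replicate_mset (count M a) a + replicate_mset (count M b) b"
proof (rule multiset_eqI)
  fix x
  show "count M x = count (replicate_mset (count M a) a + replicate_mset (count M b) b) x"
    using assms by (cases "x \<in># M") (auto simp: not_in_iff)
qed

lemma ex_partition_count_eq_Suc:
  fixes a1 a2 :: nat
  assumes "0 < a1" "a1 < a2"
  shows "\<exists>x>0. partition_count {a1, a2} x = Suc m"
proof -
  define g where "g = gcd a1 a2"
  have g: "g > 0" using assms by (simp add: g_def)
  obtain b c where bc: "a1 = b * g" "a2 = c * g" "coprime b c"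
    using gcd_coprime_exists[of a1 a2] g unfolding g_def by auto
  have b: "b > 0" and c: "c > 1" using assms bc g by (auto intro: Nat.gr0I)
  \<comment> \<open>Here \<open>b * c * g\<close> is \<open>lcm a1 a2\<close>; the summand
    \<open>a1\<close> keeps \<open>x\<close> positive even for \<open>m = 0\<close>.\<close>
  define x where "x = a1 + b * c * g * m"
  define F where "F = (\<lambda>t. replicate_mset (1 + c * t) a1 + replicate_mset (b * (m - t)) a2)"
  have count_F: "count (F t) a1 = 1 + c * t" for t
    using assms by (simp add: F_def)
  have "inj_on F {..m}"
  proof (rule inj_onI)
    fix s t assume "F s = F t"
    then have "1 + c * s = 1 + c * t" by (metis count_F)
    with c show "s = t" by simp
  qed
  moreover have "F ` {..m} = {M. set_mset M \<subseteq> {a1, a2} \<and> sum_mset M = x}"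
  proof (intro equalityI subsetI)
    fix M assume "M \<in> F ` {..m}"
    then obtain t where t: "t \<le> m" "M = F t" by auto
    \<comment> \<open>Writing \<open>m = t + s\<close> removes the truncated subtraction in
      \<open>F\<close>.\<close>
    obtain s where s: "m = t + s" using t(1) le_Suc_ex by blast
    have "sum_mset M = x"
      by (simp add: t(2) F_def x_def bc s algebra_simps)
    moreover have "set_mset M \<subseteq> {a1, a2}"
      by (auto simp: t(2) F_def split: if_splits)
    ultimately show "M \<in> {M. set_mset M \<subseteq> {a1, a2} \<and> sum_mset M = x}" by simp
  next
    fix M assume "M \<in> {M. set_mset M \<subseteq> {a1, a2} \<and> sum_mset M = x}"
    then have M: "set_mset M \<subseteq> {a1, a2}" "sum_mset M = x" by auto
    define i where "i = count M a1"
    define j where "j = count M a2"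
    have M_eq: "M = replicate_mset i a1 + replicate_mset j a2"
      using mset_two_elements[OF M(1)] assms by (simp add: i_def j_def)
    have "(i * b + j * c) * g = (b + b * c * m) * g"
      using M(2) by (subst (asm) M_eq) (simp add: x_def bc algebra_simps)
    then have eq: "i * b + j * c = b + b * c * m" using g by simp
    \<comment> \<open>Modulo \<open>c\<close> the equation reads \<open>b * i = b\<close>, and
      \<open>b\<close> is invertible. The integers are used because \<open>i - 1\<close> would
      truncate at \<open>i = 0\<close>.\<close>
    have "int c dvd int b * (int i - 1)"
    proof
      show "int b * (int i - 1) = int c * (int b * int m - int j)"
        using arg_cong[OF eq, of int] by (simp add: algebra_simps)
    qed
    then have "int c dvd int i - 1"
      using bc(3) by (simp add: coprime_dvd_mult_right_iff coprime_commute)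
    then obtain z where z: "int i - 1 = int c * z" by auto
    \<comment> \<open>\<open>i \<ge> 0\<close> excludes negative \<open>z\<close> only because \<open>c > 1\<close>, i.e. \<open>a1 < a2\<close>.\<close>
    have "z \<ge> 0"
    proof (rule ccontr)
      assume "\<not> z \<ge> 0"
      then have "int c * z \<le> int c * (-1)" by (intro mult_left_mono) auto
      with z c show False by linarith
    qed
    then obtain t where "z = int t" using nonneg_int_cases by blast
    with z have "int i = int (1 + c * t)" by simp
    then have i: "i = 1 + c * t" by (simp only: of_nat_eq_iff)
    have "c * (b * t + j) = c * (b * m)"
      using eq by (simp add: i algebra_simps)
    then have j: "b * t + j = b * m" using c by simp
    then have "t \<le> m" using b by (metis le_add1 mult_le_cancel1)
    moreover have "M = F t"
      using j by (simp add: M_eq F_def i diff_mult_distrib2 flip: j)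
    ultimately show "M \<in> F ` {..m}" by auto
  qed
  ultimately have "partition_count {a1, a2} x = Suc m"
    unfolding partition_count_def using card_image[of F "{..m}"] by simp
  moreover have "x > 0" using assms by (simp add: x_def)
  ultimately show ?thesis by blast
qed

theorem theorem2p1:
  fixes A :: "nat set" and a1 a2 :: nat and f :: "int poly"
  assumes "A = {a1, a2}"
    and "0 < a1" and "0 < a2" and "a1 \<noteq> a2"
    and "lead_coeff f > 0"
  shows "infinite {(x :: nat, y :: nat). 0 < x \<and> 0 < y \<and>
    int (partition_count A x) = poly f (int y)}"
    (is "infinite ?S")
proof
  assume "finite ?S"
  \<comment> \<open>The set is symmetric in \<open>a1\<close> and \<open>a2\<close>, so the smaller
    part may come first.\<close>
  have surj: "\<exists>x>0. partition_count A x = Suc m" for m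
    using ex_partition_count_eq_Suc[of a1 a2 m] ex_partition_count_eq_Suc[of a2 a1 m] assms
    by (cases "a1 < a2") (auto simp: insert_commute)
  obtain N where N: "\<And>y. y \<ge> N \<Longrightarrow> poly f y > 0"
    using eventually_poly_pos assms(5) by blast
  \<comment> \<open>Each large \<open>y\<close> needs just one \<open>x\<close>. The bound
    \<open>Suc (nat N)\<close> gives both \<open>y > 0\<close> and \<open>y \<ge> N\<close>, even
    for negative \<open>N\<close>.\<close>
  have "{Suc (nat N)..} \<subseteq> snd ` ?S"
  proof
    fix y assume "y \<in> {Suc (nat N)..}"
    then have y: "y > 0" "int y \<ge> N" by auto
    obtain m where m: "poly f (int y) = int (Suc m)"
      using N[OF y(2)] by (metis gr0_implies_Suc zero_less_imp_eq_int)
    obtain x where "x > 0" "partition_count A x = Suc m" using surj by blast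
    with m y have "(x, y) \<in> ?S" by simp
    then show "y \<in> snd ` ?S" by force
  qed
  with \<open>finite ?S\<close> have "finite {Suc (nat N)..}"
    by (meson finite_imageI finite_subset)
  then show False by (simp add: infinite_Ici)
qed

end
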